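(* Let $R$ be a finite rack with operations $\triangleright,\triangleleft$, let $V$ be an abelian group (written additively), and let $w\colon R\times R\to V$ be a rack 2-cocycle. Let $G$ be any group structure on the underlying set of $R$ (possibly completely independent of the rack operations), and consider the crossed module $(\partial\colon G\times V\to G,\bullet)$ with $\partial(g,v)=g$ and $g\bullet(h,v)=(ghg^{-1},v)$. Set $$\psi(b,a)=\big(b\,a\,b^{-1}(b\triangleright a)^{-1},\ w(b\triangleright a,b)\big),\qquad \phi(b,a)=\big(a\,b\,(a\triangleleft b)^{-1}b^{-1},\ -w(a,b)\big).$$ Then $\Phi=(\psi,\phi)$ is a framed Reidemeister pair, and its associated framed link invariant $I_\Phi$ coincides with the usual rack cohomology invariant $I_{R,w}$ of framed links (under the identification $\ker\partial=\{1_G\}\times V\cong V$). Moreover, if $R$ is a quandle and $w$ is a quandle 2-cocycle, then $\Phi=(\psi,\phi)$ is an unframed Reidemeister pair and its associated invariant of links coincides with the usual quandle cocycle link invariant $I_{R,w}$.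
   Context: **Racks and cocycles.** A rack is a set $R$ with two operations $\triangleright,\triangleleft\colon R\times R\to R$ such that for all $x,y,z\in R$: $x\triangleright(y\triangleleft x)=y$; $(x\triangleright y)\triangleleft x=y$; $x\triangleright(y\triangleright z)=(x\triangleright y)\triangleright(x\triangleright z)$; $(x\triangleleft y)\triangleleft z=(x\triangleleft z)\triangleleft(y\triangleleft z)$. A quandle is a rack with $x\triangleleft x=x=x\triangleright x$ for all $x$. A rack 2-cocycle is a map $w\colon R\times R\to V$ with $w(x,y)+w(x\triangleleft y,z)=w(x,z)+w(x\triangleleft z,y\triangleleft z)$ for all $x,y,z\in R$. If $R$ is a quandle, $w$ is a quandle 2-cocycle if moreover $w(x,x)=0_V$ for all $x$. **Diagrams.** An oriented tangle diagram is sliced into horizontal strips, each containing vertical strands and at most one elementary piece: the (positive) crossing $X_+$ (both strands oriented downwards, over-strand from top right to bottom left, under-strand from top left to bottom right), the (negative) crossing $X_-$ (both strands oriented downwards, over-strand from top left to bottom right, under-strand from top right to bottom left), and cups (local minima) and caps (local maxima) with either orientation. Crossings with upward strands are expressed through these pieces. A link diagram is a tangle diagram without end-points; framed links are represented with blackboard framing. **The rack/quandle cocycle invariant.** A rack colouring $c$ of a link diagram $D$ assigns an element of $R$ to each arc so that at each crossing $X_+$ with over-arc $y$ and lower (bottom right) under-arc $x$ the upper (top left) under-arc is $y\triangleright x$, and at each crossing $X_-$ with over-arc $y$ and lower (bottom left) under-arc $x$ the upper (top right) under-arc is $x\triangleleft y$. Thus at each crossing $\tau$ with over-arc coloured $y_\tau$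 there is one of the two under-arcs, with colour $x_\tau$, such that the other under-arc is coloured $x_\tau\triangleleft y_\tau$ (the incoming under-arc if $\tau$ is positive, the outgoing one if $\tau$ is negative). With $\epsilon(\tau)=\pm1$ the sign of $\tau$, the invariant is $I_{R,w}(D)=\sum_c\big[\sum_\tau\epsilon(\tau)\,w(x_\tau,y_\tau)\big]\in\mathbb Z[V]$, where $[v]$ is the basis element of the group ring corresponding to $v\in V$, the outer sum runs over rack colourings of $D$ and the inner sum over crossings. **Crossed modules.** A crossed module of groups $\mathcal G=(\partial\colon E\to G,\bullet)$ is a group homomorphism $\partial\colon E\to G$ with a left action $\bullet$ of $G$ on $E$ by automorphisms such that $\partial(g\bullet e)=g\,\partial(e)\,g^{-1}$ and $\partial(e)\bullet f=efe^{-1}$ for all $g\in G$, $e,f\in E$. **The category $\mathcal C(\mathcal G)$.** Objects are the elements of $G$. Morphisms $U\to V'$ are pairs $(U,e)$ with $e\in E$, $\partial(e)=V'U^{-1}$ (written $U\xrightarrow{e}V'$). The composite of $U\xrightarrow{e}V'$ followed by $V'\xrightarrow{f}W$ is $U\xrightarrow{fe}W$. The tensor product is $U\otimes U'=UU'$ on objects, and the tensor product of $U\xrightarrow{e}V'$ and $W\xrightarrow{f}X$ is $UW\xrightarrow{(V'\bullet f)\,e}V'X$. **Reidemeister pairs.** A pair $\Phi=(\psi,\phi)$ of functions $\psi,\phi\colon G\times G\to E$ is an *unframed Reidemeister pair* if for all $X,Y,T\in G$: (R1) $\psi(X,X)=1_E$; (R2) $\phi(X,Y)\,\psi(X,Z)=1_E$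 where $Z=X^{-1}\partial\phi(X,Y)^{-1}YX$; (R3) $\phi(Y,X)\cdot(Y\bullet\phi(T,Z))\cdot\phi(T,Y)=(X\bullet\phi(T,Y))\cdot\phi(T,X)\cdot(T\bullet\phi(P,Q))$ where $Z=Y^{-1}\partial\phi(Y,X)^{-1}XY$, $P=T^{-1}\partial\phi(T,Y)^{-1}YT$, $Q=T^{-1}\partial\phi(T,X)^{-1}XT$. It is a *framed Reidemeister pair* if (R2) and (R3) hold and moreover: (i) for each $Z\in G$ the equation $\partial(\phi(A,Z))A=Z$ has a unique solution $A=f(Z)\in G$; (ii) with $g(A)=\partial(\psi(A,A))^{-1}A$ one has $f\circ g=g\circ f=\mathrm{id}$. **Reidemeister $\mathcal G$-colourings and state sum.** A Reidemeister $\mathcal G$-colouring $F$ of a link diagram $D$ assigns an element of $G$ to each arc and an element of $E$ to each crossing so that: at each $X_+$ with over-arc coloured $X$, lower (bottom right) under-arc coloured $Y$, upper (top left) under-arc coloured $Z$, the crossing is coloured $\psi(X,Y)$ and $Z=\partial\psi(X,Y)^{-1}XYX^{-1}$; at each $X_-$ with over-arc coloured $X$, lower (bottom left) under-arc coloured $Y$, upper (top right) under-arc coloured $Z$, the crossing is coloured $\phi(X,Y)$ and $Z=X^{-1}\partial\phi(X,Y)^{-1}YX$. The evaluation $e(F)$ is the morphism $1_G\to1_G$ of $\mathcal C(\mathcal G)$, i.e. an element of $A=\ker\partial$, obtained by tensoring horizontally and composing vertically (from top to bottom) the following morphisms: $X_+\mapsto ZX\xrightarrow{\psi(X,Y)}XY$;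 $X_-\mapsto XZ\xrightarrow{\phi(X,Y)}YX$; a vertical strand coloured $X$ gives the identity of $X$ if oriented downwards and of $X^{-1}$ if upwards; cups give $XX^{-1}\xrightarrow{1_E}1_G$ or $X^{-1}X\xrightarrow{1_E}1_G$ and caps give $1_G\xrightarrow{1_E}X^{-1}X$ or $1_G\xrightarrow{1_E}XX^{-1}$, according to orientation. The state sum is $I_\Phi(D)=\sum_F e(F)\in\mathbb Z[A]$, the sum being over all Reidemeister $\mathcal G$-colourings of $D$; it is the invariant of (framed) links associated to the (framed, resp. unframed) pair $\Phi$. *)

theory Defs
  imports "HOL-Algebra.Ring" "HOL-Algebra.Coset" "HOL-Algebra.Free_Abelian_Groups"
begin

section \<open>Racks and cocycles\<close>

locale rack =
  fixes R :: "'r set"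
    and ra :: "'r \<Rightarrow> 'r \<Rightarrow> 'r" (infixl "\<triangleright>" 70)
    and la :: "'r \<Rightarrow> 'r \<Rightarrow> 'r" (infixl "\<triangleleft>" 70)
  assumes ra_closed: "\<lbrakk>x \<in> R; y \<in> R\<rbrakk> \<Longrightarrow> x \<triangleright> y \<in> R"
    and la_closed: "\<lbrakk>x \<in> R; y \<in> R\<rbrakk> \<Longrightarrow> x \<triangleleft> y \<in> R"
    and ra_la: "\<lbrakk>x \<in> R; y \<in> R\<rbrakk> \<Longrightarrow> x \<triangleright> (y \<triangleleft> x) = y"
    and la_ra: "\<lbrakk>x \<in> R; y \<in> R\<rbrakk> \<Longrightarrow> (x \<triangleright> y) \<triangleleft> x = y"
    and ra_distrib: "\<lbrakk>x \<in> R; y \<in> R; z \<in> R\<rbrakk> \<Longrightarrow> x \<triangleright> (y \<triangleright> z) = (x \<triangleright> y) \<triangleright> (x \<triangleright> z)"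
    and la_distrib: "\<lbrakk>x \<in> R; y \<in> R; z \<in> R\<rbrakk> \<Longrightarrow> (x \<triangleleft> y) \<triangleleft> z = (x \<triangleleft> z) \<triangleleft> (y \<triangleleft> z)"

locale quandle = rack +
  assumes ra_idem: "x \<in> R \<Longrightarrow> x \<triangleright> x = x"
    and la_idem: "x \<in> R \<Longrightarrow> x \<triangleleft> x = x"

text \<open>The coefficient group is written additively: it is the additive group of a
  structure satisfying \<^locale>\<open>abelian_group\<close>, whose multiplication plays no role.\<close>

definition rack_2cocycle ::
    "'r set \<Rightarrow> ('r \<Rightarrow> 'r \<Rightarrow> 'r) \<Rightarrow> ('v, 'm) ring_scheme \<Rightarrow> ('r \<Rightarrow> 'r \<Rightarrow> 'v) \<Rightarrow> bool" where
  "rack_2cocycle R la V w \<longleftrightarrow>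
     (\<forall>x\<in>R. \<forall>y\<in>R. w x y \<in> carrier V) \<and>
     (\<forall>x\<in>R. \<forall>y\<in>R. \<forall>z\<in>R.
        w x y \<oplus>\<^bsub>V\<^esub> w (la x y) z = w x z \<oplus>\<^bsub>V\<^esub> w (la x z) (la y z))"

definition quandle_2cocycle ::
    "'r set \<Rightarrow> ('r \<Rightarrow> 'r \<Rightarrow> 'r) \<Rightarrow> ('v, 'm) ring_scheme \<Rightarrow> ('r \<Rightarrow> 'r \<Rightarrow> 'v) \<Rightarrow> bool" where
  "quandle_2cocycle R la V w \<longleftrightarrow>
     rack_2cocycle R la V w \<and> (\<forall>x\<in>R. w x x = \<zero>\<^bsub>V\<^esub>)"


section \<open>Sliced oriented link diagrams\<close>

datatype orient = Down | Up

fun opp :: "orient \<Rightarrow> orient" where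
  "opp Down = Up"
| "opp Up = Down"

text \<open>\<open>Xpos\<close> and \<open>Xneg\<close> are \<open>X\<^sub>+\<close> and \<open>X\<^sub>-\<close>. The orientation stored in a cup or cap is that
  of its left strand.\<close>

datatype piece = Xpos | Xneg | Cup orient | Cap orient

text \<open>A horizontal strip: vertical strands (given by their orientations from left to right),
  at most one elementary piece, and further vertical strands.\<close>

datatype strip = Strip (lstrands: "orient list") (piece: "piece option") (rstrands: "orient list")

fun piece_top :: "piece option \<Rightarrow> orient list" where
  "piece_top None = []"
| "piece_top (Some Xpos) = [Down, Down]"
| "piece_top (Some Xneg) = [Down, Down]"
| "piece_top (Some (Cup o1)) = [o1, opp o1]"
| "piece_top (Some (Cap o1)) = []"

fun piece_bot :: "piece option \<Rightarrow> orient list" where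
  "piece_bot None = []"
| "piece_bot (Some Xpos) = [Down, Down]"
| "piece_bot (Some Xneg) = [Down, Down]"
| "piece_bot (Some (Cup o1)) = []"
| "piece_bot (Some (Cap o1)) = [o1, opp o1]"

definition strip_top :: "strip \<Rightarrow> orient list" where
  "strip_top s = lstrands s @ piece_top (piece s) @ rstrands s"

definition strip_bot :: "strip \<Rightarrow> orient list" where
  "strip_bot s = lstrands s @ piece_bot (piece s) @ rstrands s"

text \<open>Diagrams list their strips from top to bottom.\<close>

type_synonym diagram = "strip list"

fun tangle_diagram :: "orient list \<Rightarrow> diagram \<Rightarrow> orient list \<Rightarrow> bool" where
  "tangle_diagram a [] b \<longleftrightarrow> a = b"
| "tangle_diagram a (s # D) b \<longleftrightarrow> strip_top s = a \<and> tangle_diagram (strip_bot s) D b"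

definition link_diagram :: "diagram \<Rightarrow> bool" where
  "link_diagram D \<longleftrightarrow> tangle_diagram [] D []"

text \<open>The pair \<open>(i, j)\<close> is the \<open>j\<close>-th point from the left on the line bounding strip \<open>i\<close>
  from above (equivalently, bounding strip \<open>i - 1\<close> from below).\<close>

definition points :: "diagram \<Rightarrow> (nat \<times> nat) set" where
  "points D = {(i, j). i < length D \<and> j < length (strip_top (D ! i))}"

definition pos :: "diagram \<Rightarrow> nat \<Rightarrow> nat" where
  "pos D i = length (lstrands (D ! i))"

text \<open>Two points are joined if an uninterrupted piece of strand inside one strip connects
  them; strands are interrupted only where they pass under another strand.\<close>

inductive_set joined :: "diagram \<Rightarrow> ((nat \<times> nat) \<times> (nat \<times> nat)) set" for D where
  lstrand: "\<lbrakk>i < length D; j < pos D i\<rbrakk> \<Longrightarrow> ((i, j), (Suc i, j)) \<in> joined D"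
| rstrand: "\<lbrakk>i < length D; k < length (rstrands (D ! i))\<rbrakk> \<Longrightarrow>
    ((i, pos D i + length (piece_top (piece (D ! i))) + k),
     (Suc i, pos D i + length (piece_bot (piece (D ! i))) + k)) \<in> joined D"
| over_pos: "\<lbrakk>i < length D; piece (D ! i) = Some Xpos\<rbrakk> \<Longrightarrow>
    ((i, Suc (pos D i)), (Suc i, pos D i)) \<in> joined D"
| over_neg: "\<lbrakk>i < length D; piece (D ! i) = Some Xneg\<rbrakk> \<Longrightarrow>
    ((i, pos D i), (Suc i, Suc (pos D i))) \<in> joined D"
| cup: "\<lbrakk>i < length D; piece (D ! i) = Some (Cup o1)\<rbrakk> \<Longrightarrow>
    ((i, pos D i), (i, Suc (pos D i))) \<in> joined D"
| cap: "\<lbrakk>i < length D; piece (D ! i) = Some (Cap o1)\<rbrakk> \<Longrightarrow>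
    ((Suc i, pos D i), (Suc i, Suc (pos D i))) \<in> joined D"

text \<open>An arc is represented by the set of points lying on it.\<close>

definition arc_of :: "diagram \<Rightarrow> nat \<times> nat \<Rightarrow> (nat \<times> nat) set" where
  "arc_of D p = {q. (p, q) \<in> (joined D \<union> (joined D)\<inverse>)\<^sup>*}"

definition arcs :: "diagram \<Rightarrow> (nat \<times> nat) set set" where
  "arcs D = arc_of D ` points D"

text \<open>A crossing is represented by the index of the strip containing it.\<close>

definition pos_crossings :: "diagram \<Rightarrow> nat set" where
  "pos_crossings D = {i. i < length D \<and> piece (D ! i) = Some Xpos}"

definition neg_crossings :: "diagram \<Rightarrow> nat set" where
  "neg_crossings D = {i. i < length D \<and> piece (D ! i) = Some Xneg}"

definition crossings :: "diagram \<Rightarrow> nat set" where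
  "crossings D = pos_crossings D \<union> neg_crossings D"

definition over_arc :: "diagram \<Rightarrow> nat \<Rightarrow> (nat \<times> nat) set" where
  "over_arc D i = arc_of D (if i \<in> pos_crossings D then (i, Suc (pos D i)) else (i, pos D i))"

definition lower_under_arc :: "diagram \<Rightarrow> nat \<Rightarrow> (nat \<times> nat) set" where
  "lower_under_arc D i =
     arc_of D (if i \<in> pos_crossings D then (Suc i, Suc (pos D i)) else (Suc i, pos D i))"

definition upper_under_arc :: "diagram \<Rightarrow> nat \<Rightarrow> (nat \<times> nat) set" where
  "upper_under_arc D i =
     arc_of D (if i \<in> pos_crossings D then (i, pos D i) else (i, Suc (pos D i)))"

definition crossing_sign :: "diagram \<Rightarrow> nat \<Rightarrow> int" where
  "crossing_sign D i = (if i \<in> pos_crossings D then 1 else -1)"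


section \<open>The rack and quandle cocycle invariant\<close>

definition rack_colourings ::
    "'r set \<Rightarrow> ('r \<Rightarrow> 'r \<Rightarrow> 'r) \<Rightarrow> ('r \<Rightarrow> 'r \<Rightarrow> 'r) \<Rightarrow> diagram \<Rightarrow> ((nat \<times> nat) set \<Rightarrow> 'r) set" where
  "rack_colourings R ra la D = {c \<in> arcs D \<rightarrow>\<^sub>E R.
     (\<forall>i\<in>pos_crossings D. c (upper_under_arc D i) = ra (c (over_arc D i)) (c (lower_under_arc D i))) \<and>
     (\<forall>i\<in>neg_crossings D. c (upper_under_arc D i) = la (c (lower_under_arc D i)) (c (over_arc D i)))}"

text \<open>The under-arc carrying \<open>x\<^sub>\<tau>\<close>: strands at a crossing point downwards, so it is the
  incoming (upper) one at a positive crossing and the outgoing (lower) one at a negative one.\<close>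

definition source_under_arc :: "diagram \<Rightarrow> nat \<Rightarrow> (nat \<times> nat) set" where
  "source_under_arc D i =
     (if i \<in> pos_crossings D then upper_under_arc D i else lower_under_arc D i)"

text \<open>For an abelian group \<open>V\<close>, the elements of \<open>\<int>[V]\<close> are finitely supported integer-valued
  functions (type \<open>'v \<Rightarrow>\<^sub>0 int\<close>), \<open>frag_of v\<close> being the basis element \<open>[v]\<close>. Only the additive
  structure of the group ring is used. The set of colourings summed over is finite because
  \<open>R\<close> is assumed to be finite in the applications.\<close>

definition rack_cocycle_invariant ::
    "'r set \<Rightarrow> ('r \<Rightarrow> 'r \<Rightarrow> 'r) \<Rightarrow> ('r \<Rightarrow> 'r \<Rightarrow> 'r) \<Rightarrow> ('v, 'm) ring_scheme \<Rightarrow> ('r \<Rightarrow> 'r \<Rightarrow> 'v)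
      \<Rightarrow> diagram \<Rightarrow> ('v \<Rightarrow>\<^sub>0 int)" where
  "rack_cocycle_invariant R ra la V w D =
     (\<Sum>c\<in>rack_colourings R ra la D.
        frag_of (\<Oplus>\<^bsub>V\<^esub>i\<in>crossings D.
          [crossing_sign D i] \<cdot>\<^bsub>V\<^esub> w (c (source_under_arc D i)) (c (over_arc D i))))"


section \<open>Crossed modules and the associated monoidal category\<close>

record ('g, 'e) xmod =
  Egrp :: "'e monoid"
  Ggrp :: "'g monoid"
  bd :: "'e \<Rightarrow> 'g"
  act :: "'g \<Rightarrow> 'e \<Rightarrow> 'e"

definition crossed_module :: "('g, 'e) xmod \<Rightarrow> bool" where
  "crossed_module X \<longleftrightarrow>
     group (Egrp X) \<and> group (Ggrp X) \<and> bd X \<in> hom (Egrp X) (Ggrp X) \<and>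
     (\<forall>g\<in>carrier (Ggrp X). act X g \<in> iso (Egrp X) (Egrp X)) \<and>
     (\<forall>e\<in>carrier (Egrp X). act X \<one>\<^bsub>Ggrp X\<^esub> e = e) \<and>
     (\<forall>g\<in>carrier (Ggrp X). \<forall>h\<in>carrier (Ggrp X). \<forall>e\<in>carrier (Egrp X).
        act X (g \<otimes>\<^bsub>Ggrp X\<^esub> h) e = act X g (act X h e)) \<and>
     (\<forall>g\<in>carrier (Ggrp X). \<forall>e\<in>carrier (Egrp X).
        bd X (act X g e) = g \<otimes>\<^bsub>Ggrp X\<^esub> bd X e \<otimes>\<^bsub>Ggrp X\<^esub> inv\<^bsub>Ggrp X\<^esub> g) \<and>
     (\<forall>e\<in>carrier (Egrp X). \<forall>f\<in>carrier (Egrp X).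
        act X (bd X e) f = e \<otimes>\<^bsub>Egrp X\<^esub> f \<otimes>\<^bsub>Egrp X\<^esub> inv\<^bsub>Egrp X\<^esub> e)"

text \<open>A morphism from \<open>U\<close> to \<open>V\<close> is the pair \<open>(U, e)\<close> with \<open>\<partial>(e) = V U\<inverse>\<close>; the target is
  recovered as \<open>\<partial>(e) U\<close>.\<close>

definition mor_target :: "('g, 'e) xmod \<Rightarrow> 'g \<times> 'e \<Rightarrow> 'g" where
  "mor_target X m = bd X (snd m) \<otimes>\<^bsub>Ggrp X\<^esub> fst m"

definition mor_id :: "('g, 'e) xmod \<Rightarrow> 'g \<Rightarrow> 'g \<times> 'e" where
  "mor_id X U = (U, \<one>\<^bsub>Egrp X\<^esub>)"

text \<open>\<open>mor_comp X m n\<close> is \<open>m\<close> followed by \<open>n\<close>; it is meaningful if the target of \<open>m\<close> is the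
  source of \<open>n\<close>.\<close>

definition mor_comp :: "('g, 'e) xmod \<Rightarrow> 'g \<times> 'e \<Rightarrow> 'g \<times> 'e \<Rightarrow> 'g \<times> 'e" where
  "mor_comp X m n = (fst m, snd n \<otimes>\<^bsub>Egrp X\<^esub> snd m)"

definition mor_tensor :: "('g, 'e) xmod \<Rightarrow> 'g \<times> 'e \<Rightarrow> 'g \<times> 'e \<Rightarrow> 'g \<times> 'e" where
  "mor_tensor X m n =
     (fst m \<otimes>\<^bsub>Ggrp X\<^esub> fst n, act X (mor_target X m) (snd n) \<otimes>\<^bsub>Egrp X\<^esub> snd m)"


section \<open>Reidemeister pairs\<close>

definition Reidemeister_R1 :: "('g, 'e) xmod \<Rightarrow> ('g \<Rightarrow> 'g \<Rightarrow> 'e) \<Rightarrow> bool" where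
  "Reidemeister_R1 \<G> \<psi> \<longleftrightarrow> (\<forall>X\<in>carrier (Ggrp \<G>). \<psi> X X = \<one>\<^bsub>Egrp \<G>\<^esub>)"

text \<open>The element \<open>X\<inverse> \<partial>\<phi>(X,Y)\<inverse> Y X\<close>.\<close>

definition phi_under :: "('g, 'e) xmod \<Rightarrow> ('g \<Rightarrow> 'g \<Rightarrow> 'e) \<Rightarrow> 'g \<Rightarrow> 'g \<Rightarrow> 'g" where
  "phi_under \<G> \<phi> X Y =
     inv\<^bsub>Ggrp \<G>\<^esub> X \<otimes>\<^bsub>Ggrp \<G>\<^esub> inv\<^bsub>Ggrp \<G>\<^esub> (bd \<G> (\<phi> X Y)) \<otimes>\<^bsub>Ggrp \<G>\<^esub> Y \<otimes>\<^bsub>Ggrp \<G>\<^esub> X"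

definition psi_under :: "('g, 'e) xmod \<Rightarrow> ('g \<Rightarrow> 'g \<Rightarrow> 'e) \<Rightarrow> 'g \<Rightarrow> 'g \<Rightarrow> 'g" where
  "psi_under \<G> \<psi> X Y =
     inv\<^bsub>Ggrp \<G>\<^esub> (bd \<G> (\<psi> X Y)) \<otimes>\<^bsub>Ggrp \<G>\<^esub> X \<otimes>\<^bsub>Ggrp \<G>\<^esub> Y \<otimes>\<^bsub>Ggrp \<G>\<^esub> inv\<^bsub>Ggrp \<G>\<^esub> X"

definition Reidemeister_R2 ::
    "('g, 'e) xmod \<Rightarrow> ('g \<Rightarrow> 'g \<Rightarrow> 'e) \<Rightarrow> ('g \<Rightarrow> 'g \<Rightarrow> 'e) \<Rightarrow> bool" where
  "Reidemeister_R2 \<G> \<psi> \<phi> \<longleftrightarrow>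
     (\<forall>X\<in>carrier (Ggrp \<G>). \<forall>Y\<in>carrier (Ggrp \<G>).
        \<phi> X Y \<otimes>\<^bsub>Egrp \<G>\<^esub> \<psi> X (phi_under \<G> \<phi> X Y) = \<one>\<^bsub>Egrp \<G>\<^esub>)"

definition Reidemeister_R3 :: "('g, 'e) xmod \<Rightarrow> ('g \<Rightarrow> 'g \<Rightarrow> 'e) \<Rightarrow> bool" where
  "Reidemeister_R3 \<G> \<phi> \<longleftrightarrow>
     (\<forall>X\<in>carrier (Ggrp \<G>). \<forall>Y\<in>carrier (Ggrp \<G>). \<forall>T\<in>carrier (Ggrp \<G>).
        let Z = phi_under \<G> \<phi> Y X; P = phi_under \<G> \<phi> T Y; Q = phi_under \<G> \<phi> T X in
          \<phi> Y X \<otimes>\<^bsub>Egrp \<G>\<^esub> act \<G> Y (\<phi> T Z) \<otimes>\<^bsub>Egrp \<G>\<^esub> \<phi> T Y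
          = act \<G> X (\<phi> T Y) \<otimes>\<^bsub>Egrp \<G>\<^esub> \<phi> T X \<otimes>\<^bsub>Egrp \<G>\<^esub> act \<G> T (\<phi> P Q))"

definition pair_maps ::
    "('g, 'e) xmod \<Rightarrow> ('g \<Rightarrow> 'g \<Rightarrow> 'e) \<Rightarrow> ('g \<Rightarrow> 'g \<Rightarrow> 'e) \<Rightarrow> bool" where
  "pair_maps \<G> \<psi> \<phi> \<longleftrightarrow>
     (\<forall>X\<in>carrier (Ggrp \<G>). \<forall>Y\<in>carrier (Ggrp \<G>).
        \<psi> X Y \<in> carrier (Egrp \<G>) \<and> \<phi> X Y \<in> carrier (Egrp \<G>))"

definition unframed_Reidemeister_pair ::
    "('g, 'e) xmod \<Rightarrow> ('g \<Rightarrow> 'g \<Rightarrow> 'e) \<Rightarrow> ('g \<Rightarrow> 'g \<Rightarrow> 'e) \<Rightarrow> bool" where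
  "unframed_Reidemeister_pair \<G> \<psi> \<phi> \<longleftrightarrow>
     pair_maps \<G> \<psi> \<phi> \<and>
     Reidemeister_R1 \<G> \<psi> \<and> Reidemeister_R2 \<G> \<psi> \<phi> \<and> Reidemeister_R3 \<G> \<phi>"

definition framing_f :: "('g, 'e) xmod \<Rightarrow> ('g \<Rightarrow> 'g \<Rightarrow> 'e) \<Rightarrow> 'g \<Rightarrow> 'g" where
  "framing_f \<G> \<phi> Z = (THE A. A \<in> carrier (Ggrp \<G>) \<and> bd \<G> (\<phi> A Z) \<otimes>\<^bsub>Ggrp \<G>\<^esub> A = Z)"

definition framing_g :: "('g, 'e) xmod \<Rightarrow> ('g \<Rightarrow> 'g \<Rightarrow> 'e) \<Rightarrow> 'g \<Rightarrow> 'g" where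
  "framing_g \<G> \<psi> A = inv\<^bsub>Ggrp \<G>\<^esub> (bd \<G> (\<psi> A A)) \<otimes>\<^bsub>Ggrp \<G>\<^esub> A"

definition framed_Reidemeister_pair ::
    "('g, 'e) xmod \<Rightarrow> ('g \<Rightarrow> 'g \<Rightarrow> 'e) \<Rightarrow> ('g \<Rightarrow> 'g \<Rightarrow> 'e) \<Rightarrow> bool" where
  "framed_Reidemeister_pair \<G> \<psi> \<phi> \<longleftrightarrow>
     pair_maps \<G> \<psi> \<phi> \<and>
     Reidemeister_R2 \<G> \<psi> \<phi> \<and> Reidemeister_R3 \<G> \<phi> \<and>
     (\<forall>Z\<in>carrier (Ggrp \<G>).
        \<exists>!A. A \<in> carrier (Ggrp \<G>) \<and> bd \<G> (\<phi> A Z) \<otimes>\<^bsub>Ggrp \<G>\<^esub> A = Z) \<and>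
     (\<forall>A\<in>carrier (Ggrp \<G>).
        framing_f \<G> \<phi> (framing_g \<G> \<psi> A) = A \<and> framing_g \<G> \<psi> (framing_f \<G> \<phi> A) = A)"


section \<open>Reidemeister colourings and the state sum\<close>

text \<open>A colouring is a pair of a colouring of the arcs by elements of \<open>G\<close> and a colouring of
  the crossings by elements of \<open>E\<close>.\<close>

type_synonym ('g, 'e) colouring = "((nat \<times> nat) set \<Rightarrow> 'g) \<times> (nat \<Rightarrow> 'e)"

definition Reidemeister_colourings ::
    "('g, 'e) xmod \<Rightarrow> ('g \<Rightarrow> 'g \<Rightarrow> 'e) \<Rightarrow> ('g \<Rightarrow> 'g \<Rightarrow> 'e) \<Rightarrow> diagram \<Rightarrow> ('g, 'e) colouring set" where
  "Reidemeister_colourings \<G> \<psi> \<phi> D =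
     {(c, d). c \<in> arcs D \<rightarrow>\<^sub>E carrier (Ggrp \<G>) \<and> d \<in> crossings D \<rightarrow>\<^sub>E carrier (Egrp \<G>) \<and>
       (\<forall>i\<in>pos_crossings D.
          d i = \<psi> (c (over_arc D i)) (c (lower_under_arc D i)) \<and>
          c (upper_under_arc D i) = psi_under \<G> \<psi> (c (over_arc D i)) (c (lower_under_arc D i))) \<and>
       (\<forall>i\<in>neg_crossings D.
          d i = \<phi> (c (over_arc D i)) (c (lower_under_arc D i)) \<and>
          c (upper_under_arc D i) = phi_under \<G> \<phi> (c (over_arc D i)) (c (lower_under_arc D i)))}"

fun strand_obj :: "('g, 'e) xmod \<Rightarrow> orient \<Rightarrow> 'g \<Rightarrow> 'g" where
  "strand_obj \<G> Down X = X"
| "strand_obj \<G> Up X = inv\<^bsub>Ggrp \<G>\<^esub> X"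

text \<open>The morphisms of the vertical strands of the given orientations which meet the line above
  strip \<open>i\<close> in the positions from \<open>k\<close> onwards.\<close>

definition strand_mors ::
    "('g, 'e) xmod \<Rightarrow> diagram \<Rightarrow> ('g, 'e) colouring \<Rightarrow> nat \<Rightarrow> nat \<Rightarrow> orient list \<Rightarrow> ('g \<times> 'e) list" where
  "strand_mors \<G> D F i k os =
     map (\<lambda>j. mor_id \<G> (strand_obj \<G> (os ! j) (fst F (arc_of D (i, k + j))))) [0..<length os]"

text \<open>The crossing \<open>X\<^sub>+\<close> gives \<open>Z X \<rightarrow> X Y\<close> and \<open>X\<^sub>-\<close> gives \<open>X Z \<rightarrow> Y X\<close>, with \<open>X\<close> the colour of
  the over-arc, \<open>Y\<close> and \<open>Z\<close> those of the lower and upper under-arcs; the \<open>E\<close>-component is the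
  colour of the crossing.\<close>

definition piece_mors ::
    "('g, 'e) xmod \<Rightarrow> diagram \<Rightarrow> ('g, 'e) colouring \<Rightarrow> nat \<Rightarrow> ('g \<times> 'e) list" where
  "piece_mors \<G> D F i = (case piece (D ! i) of
      None \<Rightarrow> []
    | Some Xpos \<Rightarrow>
        [(fst F (upper_under_arc D i) \<otimes>\<^bsub>Ggrp \<G>\<^esub> fst F (over_arc D i), snd F i)]
    | Some Xneg \<Rightarrow>
        [(fst F (over_arc D i) \<otimes>\<^bsub>Ggrp \<G>\<^esub> fst F (upper_under_arc D i), snd F i)]
    | Some (Cup o1) \<Rightarrow>
        (let X = fst F (arc_of D (i, pos D i)) in
          [(strand_obj \<G> o1 X \<otimes>\<^bsub>Ggrp \<G>\<^esub> strand_obj \<G> (opp o1) X, \<one>\<^bsub>Egrp \<G>\<^esub>)])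
    | Some (Cap o1) \<Rightarrow> [(\<one>\<^bsub>Ggrp \<G>\<^esub>, \<one>\<^bsub>Egrp \<G>\<^esub>)])"

definition strip_mor ::
    "('g, 'e) xmod \<Rightarrow> diagram \<Rightarrow> ('g, 'e) colouring \<Rightarrow> nat \<Rightarrow> 'g \<times> 'e" where
  "strip_mor \<G> D F i =
     foldr (mor_tensor \<G>)
       (strand_mors \<G> D F i 0 (lstrands (D ! i)) @
        piece_mors \<G> D F i @
        strand_mors \<G> D F i (pos D i + length (piece_top (piece (D ! i)))) (rstrands (D ! i)))
       (mor_id \<G> \<one>\<^bsub>Ggrp \<G>\<^esub>)"

text \<open>The morphism \<open>1 \<rightarrow> 1\<close>, identified with its \<open>E\<close>-component.\<close>

definition evaluation :: "('g, 'e) xmod \<Rightarrow> diagram \<Rightarrow> ('g, 'e) colouring \<Rightarrow> 'e" where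
  "evaluation \<G> D F =
     snd (foldl (mor_comp \<G>) (mor_id \<G> \<one>\<^bsub>Ggrp \<G>\<^esub>) (map (strip_mor \<G> D F) [0..<length D]))"

definition state_sum ::
    "('g, 'e) xmod \<Rightarrow> ('g \<Rightarrow> 'g \<Rightarrow> 'e) \<Rightarrow> ('g \<Rightarrow> 'g \<Rightarrow> 'e) \<Rightarrow> diagram \<Rightarrow> ('e \<Rightarrow>\<^sub>0 int)" where
  "state_sum \<G> \<psi> \<phi> D =
     (\<Sum>F\<in>Reidemeister_colourings \<G> \<psi> \<phi> D. frag_of (evaluation \<G> D F))"


section \<open>The crossed module of a group and an abelian group\<close>

definition product_xmod :: "'g monoid \<Rightarrow> ('v, 'm) ring_scheme \<Rightarrow> ('g, 'g \<times> 'v) xmod" where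
  "product_xmod G V =
     \<lparr>Egrp = G \<times>\<times> add_monoid V,
      Ggrp = G,
      bd = fst,
      act = (\<lambda>g (h, v). (g \<otimes>\<^bsub>G\<^esub> h \<otimes>\<^bsub>G\<^esub> inv\<^bsub>G\<^esub> g, v))\<rparr>"

end

theory Submission
  imports Defs
begin

text \<open>The \<open>G\<close>-components of \<open>\<psi>\<close> and \<open>\<phi>\<close> are chosen so that the group operation cancels from the
  colouring rules: at a crossing the upper under-arc is coloured \<open>b \<triangleright> a\<close>, respectively \<open>a \<triangleleft> b\<close>.
  Hence Reidemeister colourings are rack colourings, (R2) and (R3) reduce to the rack axioms and
  the cocycle identity, and the framing maps are \<open>f(Z) = Z \<triangleleft> Z\<close> and \<open>g(A) = A \<triangleright> A\<close>. In any crossed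
  module the strips of a coloured link diagram compose to a morphism \<open>1 \<rightarrow> 1\<close>, so the evaluation
  lies in \<open>ker \<partial>\<close> and only its \<open>V\<close>-component matters. As \<open>G\<close> does not act on \<open>V\<close> and \<open>V\<close> is
  abelian, that component is the sum of the \<open>V\<close>-components of the crossings.\<close>

section \<open>Groups and racks\<close>

context group
begin

lemma inv_cancel_left:
  assumes "x \<in> carrier G" "y \<in> carrier G"
  shows "inv x \<otimes> (x \<otimes> y) = y" "x \<otimes> (inv x \<otimes> y) = y"
  using assms by (simp_all flip: m_assoc)

text \<open>Splits the product of a concatenated list at a segment boundary, so that a segment can
  be exchanged for another one with the same product.\<close>

lemma mult_foldr:
  assumes "set xs \<subseteq> carrier G" "y \<in> carrier G"
  shows "foldr (\<otimes>) xs y = foldr (\<otimes>) xs \<one> \<otimes> y"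
    and "foldr (\<otimes>) xs \<one> \<in> carrier G"
proof -
  have closed: "foldr (\<otimes>) zs \<one> \<in> carrier G" if "set zs \<subseteq> carrier G" for zs
    using that by (induction zs) auto
  show "foldr (\<otimes>) xs \<one> \<in> carrier G"
    using assms closed by blast
  show "foldr (\<otimes>) xs y = foldr (\<otimes>) xs \<one> \<otimes> y"
    using assms by (induction xs) (auto simp: m_assoc closed)
qed

end

section \<open>Squares and fixed points in a rack\<close>

context rack
begin

text \<open>Self-distributivity for \<open>y \<triangleright> x\<close>, \<open>y\<close>,
  \<open>y\<close>, since acting by \<open>y\<close> on the right sends
  \<open>y \<triangleright> x\<close> to \<open>x\<close>. So \<open>y\<close> and
  \<open>y \<triangleleft> y\<close> act alike even when they differ.\<close>

lemma la_square:
  assumes "x \<in> R" "y \<in> R"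
  shows "x \<triangleleft> (y \<triangleleft> y) = x \<triangleleft> y"
  using la_distrib[of "y \<triangleright> x" y y] assms by (simp add: la_ra ra_closed la_closed)

lemma ra_square:
  assumes "x \<in> R" "y \<in> R"
  shows "(y \<triangleright> y) \<triangleright> x = y \<triangleright> x"
  using ra_distrib[of y y "x \<triangleleft> y"] assms by (simp add: ra_la ra_closed la_closed)

text \<open>The second factor \<open>x \<triangleleft> x\<close> equals
  \<open>x \<triangleleft> (x \<triangleleft> x)\<close>, which left action by
  \<open>x \<triangleleft> x\<close> sends back to \<open>x\<close>. Together with
  \<open>la_ra_square\<close> this makes the two squaring maps mutually inverse, as the framing
  condition demands.\<close>

lemma ra_la_square:
  assumes "x \<in> R"
  shows "(x \<triangleleft> x) \<triangleright> (x \<triangleleft> x) = x"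
proof -
  have "x \<triangleleft> (x \<triangleleft> x) = x \<triangleleft> x"
    using assms by (rule la_square[OF _ assms])
  then show ?thesis
    using ra_la[of "x \<triangleleft> x" x] assms by (simp add: la_closed)
qed

lemma la_ra_square:
  assumes "x \<in> R"
  shows "(x \<triangleright> x) \<triangleleft> (x \<triangleright> x) = x"
proof -
  have "(x \<triangleright> x) \<triangleright> x = x \<triangleright> x"
    using assms by (rule ra_square[OF _ assms])
  then show ?thesis
    using la_ra[of "x \<triangleright> x" x] assms by (simp add: ra_closed)
qed

text \<open>If \<open>y \<triangleleft> x = x\<close>, then \<open>y = x \<triangleright> (y
  \<triangleleft> x) = x \<triangleright> x\<close>, and squaring with
  \<open>\<triangleleft>\<close> recovers \<open>x\<close>. The converse is
  \<open>la_square\<close>.\<close>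

lemma la_fixed_iff:
  assumes "x \<in> R" "y \<in> R"
  shows "y \<triangleleft> x = x \<longleftrightarrow> x = y \<triangleleft> y"
  using assms by (metis la_ra_square la_square ra_la)

end

section \<open>Arcs of link diagrams\<close>

text \<open>Arcs are classes of an equivalence relation: the closure is taken over a symmetrised
  relation, hence is itself symmetric.\<close>

lemma arc_of_joined:
  assumes "(p, q) \<in> joined D"
  shows "arc_of D p = arc_of D q"
proof -
  have sym: "sym ((joined D \<union> (joined D)\<inverse>)\<^sup>*)"
    by (intro sym_rtrancl sym_Un_converse)
  have "(p, q) \<in> (joined D \<union> (joined D)\<inverse>)\<^sup>*"
    using assms by blast
  with sym show ?thesis
    unfolding arc_of_def by (auto dest: symD intro: rtrancl_trans)
qed

lemma finite_arcs: "finite (arcs D)"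
proof -
  have "points D \<subseteq> (\<Union>i<length D. {i} \<times> {..<length (strip_top (D ! i))})"
    by (auto simp: points_def)
  then have "finite (points D)"
    by (rule finite_subset) auto
  then show ?thesis
    by (simp add: arcs_def)
qed

lemma crossings_subset: "crossings D \<subseteq> {..<length D}"
  by (auto simp: crossings_def pos_crossings_def neg_crossings_def)

lemma pos_neg_crossings_disjoint: "pos_crossings D \<inter> neg_crossings D = {}"
  by (auto simp: pos_crossings_def neg_crossings_def)

text \<open>The default \<open>[]\<close> at \<open>i = length D\<close> is the boundary below the
  last strip, which is empty for a link diagram.\<close>

definition line :: "diagram \<Rightarrow> nat \<Rightarrow> orient list" where
  "line D i = (if i < length D then strip_top (D ! i) else [])"

lemma tangle_diagram_strip_bot:
  assumes "tangle_diagram a D b" "i < length D"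
  shows "strip_bot (D ! i) = (if Suc i < length D then strip_top (D ! Suc i) else b)"
  using assms
proof (induction D arbitrary: a i)
  case (Cons s D)
  show ?case
  proof (cases i)
    case 0
    with Cons.prems show ?thesis by (cases D) auto
  next
    case (Suc j)
    with Cons.prems Cons.IH[of "strip_bot s" j] show ?thesis by simp
  qed
qed simp

lemma line_Suc:
  assumes "link_diagram D" "i < length D"
  shows "line D (Suc i) = strip_bot (D ! i)"
  using tangle_diagram_strip_bot[of "[]" D "[]" i] assms by (simp add: line_def link_diagram_def)

lemma line_0: "link_diagram D \<Longrightarrow> line D 0 = []"
  by (cases D) (auto simp: line_def link_diagram_def)

lemma arc_of_in_arcs:
  assumes "j < length (line D i)"
  shows "arc_of D (i, j) \<in> arcs D"
  using assms by (auto simp: arcs_def points_def line_def split: if_splits)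

text \<open>The lower ends of a crossing lie on the next line. They are points of the diagram
  because a link diagram has no end-points, so a crossing is never in its last strip.\<close>

lemma crossing_arcs:
  assumes "link_diagram D" "i \<in> crossings D"
  shows "over_arc D i \<in> arcs D" "lower_under_arc D i \<in> arcs D" "upper_under_arc D i \<in> arcs D"
proof -
  have i: "i < length D" and pc: "piece (D ! i) = Some Xpos \<or> piece (D ! i) = Some Xneg"
    using assms by (auto simp: crossings_def pos_crossings_def neg_crossings_def)
  have "Suc (pos D i) < length (line D i)" "Suc (pos D i) < length (line D (Suc i))"
    using i pc line_Suc[OF assms(1) i]
    by (auto simp: pos_def line_def strip_top_def strip_bot_def)
  then show "over_arc D i \<in> arcs D" "lower_under_arc D i \<in> arcs D" "upper_under_arc D i \<in> arcs D"
    by (auto simp: over_arc_def lower_under_arc_def upper_under_arc_def intro: arc_of_in_arcs)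
qed

section \<open>Evaluation in a crossed module\<close>

locale crossed_mod =
  fixes X :: "('g, 'e) xmod"
  assumes crossed_module: "crossed_module X"
begin

sublocale Egrp: group "Egrp X"
  using crossed_module by (simp add: crossed_module_def)

sublocale Ggrp: group "Ggrp X"
  using crossed_module by (simp add: crossed_module_def)

sublocale bd: group_hom "Egrp X" "Ggrp X" "bd X"
  using crossed_module
  by (simp add: crossed_module_def group_hom_def group_hom_axioms_def)

lemma act_closed:
  assumes "g \<in> carrier (Ggrp X)" "e \<in> carrier (Egrp X)"
  shows "act X g e \<in> carrier (Egrp X)"
  using crossed_module assms by (auto simp: crossed_module_def iso_def hom_def)

lemma bd_act:
  assumes "g \<in> carrier (Ggrp X)" "e \<in> carrier (Egrp X)"
  shows "bd X (act X g e) = g \<otimes>\<^bsub>Ggrp X\<^esub> bd X e \<otimes>\<^bsub>Ggrp X\<^esub> inv\<^bsub>Ggrp X\<^esub> g"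
  using crossed_module assms by (auto simp: crossed_module_def)

text \<open>Every such pair is a morphism, because its target is computed from source and
  \<open>E\<close>-component.\<close>

definition mors :: "('g \<times> 'e) set" where
  "mors = carrier (Ggrp X) \<times> carrier (Egrp X)"

lemma mor_target_closed: "m \<in> mors \<Longrightarrow> mor_target X m \<in> carrier (Ggrp X)"
  by (auto simp: mors_def mor_target_def)

lemma mor_id:
  assumes "U \<in> carrier (Ggrp X)"
  shows "mor_id X U \<in> mors" "fst (mor_id X U) = U" "mor_target X (mor_id X U) = U"
  using assms by (auto simp: mors_def mor_target_def mor_id_def)

lemma mor_comp:
  assumes "m \<in> mors" "n \<in> mors" "mor_target X m = fst n"
  shows "mor_comp X m n \<in> mors" "fst (mor_comp X m n) = fst m"
    "mor_target X (mor_comp X m n) = mor_target X n"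
  using assms by (auto simp: mors_def mor_target_def mor_comp_def Ggrp.m_assoc)

text \<open>Targets multiply by equivariance of \<open>bd\<close>: with
  \<open>T = mor_target X m\<close>, the boundary of the new \<open>E\<close>-component is
  \<open>T \<partial>(snd n) T\<inverse> \<partial>(snd m)\<close>, and
  \<open>\<partial>(snd m)\<close> times the source of \<open>m\<close> is \<open>T\<close>, which
  cancels \<open>T\<inverse>\<close>.\<close>

lemma mor_tensor:
  assumes "m \<in> mors" "n \<in> mors"
  shows "mor_tensor X m n \<in> mors"
    "fst (mor_tensor X m n) = fst m \<otimes>\<^bsub>Ggrp X\<^esub> fst n"
    "mor_target X (mor_tensor X m n) = mor_target X m \<otimes>\<^bsub>Ggrp X\<^esub> mor_target X n"
  using assms mor_target_closed[OF assms(1)]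
  by (auto simp: mors_def mor_target_def mor_tensor_def act_closed bd_act Ggrp.m_assoc
      Ggrp.inv_mult_group Ggrp.inv_cancel_left)

lemma foldr_mor_tensor:
  assumes "set ms \<subseteq> mors"
  defines "m \<equiv> foldr (mor_tensor X) ms (mor_id X \<one>\<^bsub>Ggrp X\<^esub>)"
  shows "m \<in> mors"
    "fst m = foldr (\<otimes>\<^bsub>Ggrp X\<^esub>) (map fst ms) \<one>\<^bsub>Ggrp X\<^esub>"
    "mor_target X m = foldr (\<otimes>\<^bsub>Ggrp X\<^esub>) (map (mor_target X) ms) \<one>\<^bsub>Ggrp X\<^esub>"
  using assms(1) unfolding m_def by (induction ms) (auto simp: mor_id mor_tensor)

end

section \<open>Objects along the lines of a coloured diagram\<close>

definition strand_objs ::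
    "('g, 'e) xmod \<Rightarrow> diagram \<Rightarrow> ('g, 'e) colouring \<Rightarrow> nat \<Rightarrow> nat \<Rightarrow> orient list \<Rightarrow> 'g list" where
  "strand_objs X D F i k os =
     map (\<lambda>j. strand_obj X (os ! j) (fst F (arc_of D (i, k + j)))) [0..<length os]"

lemma strand_objs_Nil [simp]: "strand_objs X D F i k [] = []"
  by (simp add: strand_objs_def)

lemma strand_objs_Cons [simp]:
  "strand_objs X D F i k (a # os) =
     strand_obj X a (fst F (arc_of D (i, k))) # strand_objs X D F i (Suc k) os"
  by (rule nth_equalityI) (auto simp: strand_objs_def nth_Cons' simp del: upt_Suc)

lemma strand_objs_append:
  "strand_objs X D F i k (as @ bs) =
     strand_objs X D F i k as @ strand_objs X D F i (k + length as) bs"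
  by (induction as arbitrary: k) auto

lemma strand_mors_eq: "strand_mors X D F i k os = map (mor_id X) (strand_objs X D F i k os)"
  by (simp add: strand_mors_def strand_objs_def)

lemma strand_objs_cong:
  assumes "\<And>j. j < length os \<Longrightarrow> arc_of D (i, k + j) = arc_of D (i', k' + j)"
  shows "strand_objs X D F i k os = strand_objs X D F i' k' os"
  using assms by (simp add: strand_objs_def)

text \<open>The product of this list is the object of the monoidal category carried by the line; the
  list form allows cutting the line into segments.\<close>

definition line_objs ::
    "('g, 'e) xmod \<Rightarrow> diagram \<Rightarrow> ('g, 'e) colouring \<Rightarrow> nat \<Rightarrow> 'g list" where
  "line_objs X D F i = strand_objs X D F i 0 (line D i)"

locale coloured_link = crossed_mod X for X :: "('g, 'e) xmod" +
  fixes \<psi> \<phi> :: "'g \<Rightarrow> 'g \<Rightarrow> 'e" and D :: diagram and F :: "('g, 'e) colouring"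
  assumes link: "link_diagram D" and colouring: "F \<in> Reidemeister_colourings X \<psi> \<phi> D"
begin

lemma colour_closed: "a \<in> arcs D \<Longrightarrow> fst F a \<in> carrier (Ggrp X)"
  using colouring by (auto simp: Reidemeister_colourings_def PiE_iff)

lemma crossing_colour_closed: "i \<in> crossings D \<Longrightarrow> snd F i \<in> carrier (Egrp X)"
  using colouring by (auto simp: Reidemeister_colourings_def PiE_iff)

lemma strand_obj_closed:
  "x \<in> carrier (Ggrp X) \<Longrightarrow> strand_obj X a x \<in> carrier (Ggrp X)"
  by (cases a) auto

lemma strand_obj_opp:
  "x \<in> carrier (Ggrp X) \<Longrightarrow>
     strand_obj X a x \<otimes>\<^bsub>Ggrp X\<^esub> strand_obj X (opp a) x = \<one>\<^bsub>Ggrp X\<^esub>"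
  by (cases a) auto

lemma line_objs_closed: "set (line_objs X D F i) \<subseteq> carrier (Ggrp X)"
  by (auto simp: line_objs_def strand_objs_def intro!: strand_obj_closed colour_closed arc_of_in_arcs)

text \<open>A vertical strand stays on one arc and keeps its colour across the strip. Hence both
  lines share their outer segments, here read on the upper line, and differ only at the elementary
  piece.\<close>

lemma line_objs_split:
  assumes "i < length D"
  shows "line_objs X D F i =
      strand_objs X D F i 0 (lstrands (D ! i)) @
      strand_objs X D F i (pos D i) (piece_top (piece (D ! i))) @
      strand_objs X D F i (pos D i + length (piece_top (piece (D ! i)))) (rstrands (D ! i))" (is ?top)
    and "line_objs X D F (Suc i) =
      strand_objs X D F i 0 (lstrands (D ! i)) @
      strand_objs X D F (Suc i) (pos D i) (piece_bot (piece (D ! i))) @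
      strand_objs X D F i (pos D i + length (piece_top (piece (D ! i)))) (rstrands (D ! i))" (is ?bot)
proof -
  show ?top
    using assms by (simp add: line_objs_def line_def strip_top_def strand_objs_append pos_def)
  have "strand_objs X D F i 0 (lstrands (D ! i)) = strand_objs X D F (Suc i) 0 (lstrands (D ! i))"
    using assms by (intro strand_objs_cong arc_of_joined) (auto simp: pos_def intro: joined.lstrand)
  moreover have "strand_objs X D F i (pos D i + length (piece_top (piece (D ! i)))) (rstrands (D ! i))
      = strand_objs X D F (Suc i) (pos D i + length (piece_bot (piece (D ! i)))) (rstrands (D ! i))"
    using assms by (intro strand_objs_cong arc_of_joined) (auto intro: joined.rstrand)
  ultimately show ?bot
    using line_Suc[OF link assms]
    by (simp add: line_objs_def strip_bot_def strand_objs_append pos_def)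
qed

text \<open>At a crossing this is the colouring rule for the upper under-arc; at a cup or cap both
  ends lie on one arc, so their objects are mutually inverse. Only products can be compared, since a
  piece is one morphism while its ends may be two strands.\<close>

lemma piece_mors:
  assumes i: "i < length D"
  shows "set (piece_mors X D F i) \<subseteq> mors"
    "foldr (\<otimes>\<^bsub>Ggrp X\<^esub>) (map fst (piece_mors X D F i)) \<one>\<^bsub>Ggrp X\<^esub>
       = foldr (\<otimes>\<^bsub>Ggrp X\<^esub>) (strand_objs X D F i (pos D i) (piece_top (piece (D ! i)))) \<one>\<^bsub>Ggrp X\<^esub>"
    "foldr (\<otimes>\<^bsub>Ggrp X\<^esub>) (map (mor_target X) (piece_mors X D F i)) \<one>\<^bsub>Ggrp X\<^esub>
       = foldr (\<otimes>\<^bsub>Ggrp X\<^esub>) (strand_objs X D F (Suc i) (pos D i) (piece_bot (piece (D ! i)))) \<one>\<^bsub>Ggrp X\<^esub>"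
proof -
  let ?p = "piece (D ! i)"
  define top where "top = strand_objs X D F i (pos D i) (piece_top ?p)"
  define bot where "bot = strand_objs X D F (Suc i) (pos D i) (piece_bot ?p)"
  define ms where "ms = piece_mors X D F i"
  define mulG where "mulG = mult (Ggrp X)"
  have "set ms \<subseteq> mors \<and> foldr mulG (map fst ms) \<one>\<^bsub>Ggrp X\<^esub> = foldr mulG top \<one>\<^bsub>Ggrp X\<^esub> \<and>
    foldr mulG (map (mor_target X) ms) \<one>\<^bsub>Ggrp X\<^esub> = foldr mulG bot \<one>\<^bsub>Ggrp X\<^esub>"
  proof (cases ?p)
    case None
    then show ?thesis by (simp add: ms_def top_def bot_def piece_mors_def)
  next
    case (Some q)
    show ?thesis
    proof (cases q)
      case Xpos
      with Some have p: "?p = Some Xpos" by simp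
      then have mem: "i \<in> pos_crossings D" using i by (simp add: pos_crossings_def)
      then have cr: "i \<in> crossings D" by (simp add: crossings_def)
      have over: "arc_of D (i, Suc (pos D i)) = over_arc D i"
          "arc_of D (Suc i, pos D i) = over_arc D i"
        using mem arc_of_joined[OF joined.over_pos[OF i p]] by (auto simp: over_arc_def)
      have under: "arc_of D (i, pos D i) = upper_under_arc D i"
          "arc_of D (Suc i, Suc (pos D i)) = lower_under_arc D i"
        using mem by (auto simp: upper_under_arc_def lower_under_arc_def)
      note [simp] = colour_closed[OF crossing_arcs(1)[OF link cr]]
        colour_closed[OF crossing_arcs(2)[OF link cr]] crossing_colour_closed[OF cr]
      \<comment> \<open>Multiplied out, the rule says that \<open>bd X (snd F i)\<close> carries the
        source \<open>Z X\<close> of the crossing morphism to \<open>X Y\<close>; it also shows that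
        the upper colour lies in the group.\<close>
      have up: "fst F (upper_under_arc D i)
          = inv\<^bsub>Ggrp X\<^esub> (bd X (snd F i)) \<otimes>\<^bsub>Ggrp X\<^esub> fst F (over_arc D i)
            \<otimes>\<^bsub>Ggrp X\<^esub> fst F (lower_under_arc D i) \<otimes>\<^bsub>Ggrp X\<^esub> inv\<^bsub>Ggrp X\<^esub> fst F (over_arc D i)"
        using colouring mem by (auto simp: Reidemeister_colourings_def psi_under_def)
      show ?thesis
        by (simp add: ms_def mulG_def top_def bot_def p piece_mors_def mors_def mor_target_def over under)
          (simp add: up Ggrp.m_assoc Ggrp.inv_cancel_left)
    next
      case Xneg
      with Some have p: "?p = Some Xneg" by simp
      then have mem: "i \<in> neg_crossings D" "i \<notin> pos_crossings D"
        using i by (auto simp: pos_crossings_def neg_crossings_def)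
      then have cr: "i \<in> crossings D" by (simp add: crossings_def)
      have over: "arc_of D (i, pos D i) = over_arc D i"
          "arc_of D (Suc i, Suc (pos D i)) = over_arc D i"
        using mem arc_of_joined[OF joined.over_neg[OF i p]] by (auto simp: over_arc_def)
      have under: "arc_of D (i, Suc (pos D i)) = upper_under_arc D i"
          "arc_of D (Suc i, pos D i) = lower_under_arc D i"
        using mem by (auto simp: upper_under_arc_def lower_under_arc_def)
      note [simp] = colour_closed[OF crossing_arcs(1)[OF link cr]]
        colour_closed[OF crossing_arcs(2)[OF link cr]] crossing_colour_closed[OF cr]
      have up: "fst F (upper_under_arc D i)
          = inv\<^bsub>Ggrp X\<^esub> fst F (over_arc D i) \<otimes>\<^bsub>Ggrp X\<^esub> inv\<^bsub>Ggrp X\<^esub> (bd X (snd F i))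
            \<otimes>\<^bsub>Ggrp X\<^esub> fst F (lower_under_arc D i) \<otimes>\<^bsub>Ggrp X\<^esub> fst F (over_arc D i)"
        using colouring mem by (auto simp: Reidemeister_colourings_def phi_under_def)
      show ?thesis
        by (simp add: ms_def mulG_def top_def bot_def p piece_mors_def mors_def mor_target_def over under)
          (simp add: up Ggrp.m_assoc Ggrp.inv_cancel_left)
    next
      case (Cup a)
      with Some have p: "?p = Some (Cup a)" by simp
      have "pos D i < length (line D i)"
        using i p by (simp add: line_def strip_top_def pos_def)
      note [simp] = colour_closed[OF arc_of_in_arcs[OF this]]
      have "arc_of D (i, Suc (pos D i)) = arc_of D (i, pos D i)"
        using arc_of_joined[OF joined.cup[OF i p]] by simp
      then show ?thesis
        by (simp add: ms_def mulG_def top_def bot_def p piece_mors_def mors_def mor_target_def Let_def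
            strand_obj_closed strand_obj_opp)
    next
      case (Cap a)
      with Some have p: "?p = Some (Cap a)" by simp
      have "pos D i < length (line D (Suc i))"
        using line_Suc[OF link i] p by (simp add: strip_bot_def pos_def)
      note [simp] = colour_closed[OF arc_of_in_arcs[OF this]]
      have "arc_of D (Suc i, Suc (pos D i)) = arc_of D (Suc i, pos D i)"
        using arc_of_joined[OF joined.cap[OF i p]] by simp
      then show ?thesis
        by (simp add: ms_def mulG_def top_def bot_def p piece_mors_def mors_def mor_target_def Let_def
            strand_obj_closed strand_obj_opp)
    qed
  qed
  then show "set (piece_mors X D F i) \<subseteq> mors"
    "foldr (\<otimes>\<^bsub>Ggrp X\<^esub>) (map fst (piece_mors X D F i)) \<one>\<^bsub>Ggrp X\<^esub>
       = foldr (\<otimes>\<^bsub>Ggrp X\<^esub>) (strand_objs X D F i (pos D i) (piece_top ?p)) \<one>\<^bsub>Ggrp X\<^esub>"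
    "foldr (\<otimes>\<^bsub>Ggrp X\<^esub>) (map (mor_target X) (piece_mors X D F i)) \<one>\<^bsub>Ggrp X\<^esub>
       = foldr (\<otimes>\<^bsub>Ggrp X\<^esub>) (strand_objs X D F (Suc i) (pos D i) (piece_bot ?p)) \<one>\<^bsub>Ggrp X\<^esub>"
    by (simp_all add: ms_def top_def bot_def mulG_def)
qed

lemma strip_mors_closed:
  assumes "i < length D"
  shows "set (strand_mors X D F i 0 (lstrands (D ! i)) @ piece_mors X D F i @
    strand_mors X D F i (pos D i + length (piece_top (piece (D ! i)))) (rstrands (D ! i))) \<subseteq> mors"
  using line_objs_closed[of i] piece_mors(1)[OF assms]
  by (auto simp: line_objs_split(1)[OF assms] strand_mors_eq mor_id)

text \<open>Tensoring multiplies sources and targets from left to right. Vertical strands are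
  identities, and the piece contributes the products of its upper and lower ends.\<close>

lemma strip_mor:
  assumes i: "i < length D"
  shows "strip_mor X D F i \<in> mors"
    "fst (strip_mor X D F i) = foldr (\<otimes>\<^bsub>Ggrp X\<^esub>) (line_objs X D F i) \<one>\<^bsub>Ggrp X\<^esub>"
    "mor_target X (strip_mor X D F i) = foldr (\<otimes>\<^bsub>Ggrp X\<^esub>) (line_objs X D F (Suc i)) \<one>\<^bsub>Ggrp X\<^esub>"
proof -
  define L where "L = strand_objs X D F i 0 (lstrands (D ! i))"
  define S where "S = strand_objs X D F i (pos D i + length (piece_top (piece (D ! i)))) (rstrands (D ! i))"
  have LS: "set L \<subseteq> carrier (Ggrp X)" "set S \<subseteq> carrier (Ggrp X)"
    using line_objs_closed[of i] by (auto simp: line_objs_split(1)[OF i] L_def S_def)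
  have maps: "map fst (map (mor_id X) zs) = zs" "map (mor_target X) (map (mor_id X) zs) = zs"
    if "set zs \<subseteq> carrier (Ggrp X)" for zs
    using that by (auto simp: mor_id intro!: map_idI)
  \<comment> \<open>Exchanges the source or target of the piece for the list of objects at its ends,
    between unchanged strands.\<close>
  have swap: "foldr (\<otimes>\<^bsub>Ggrp X\<^esub>) (L @ xs @ S) \<one>\<^bsub>Ggrp X\<^esub> = foldr (\<otimes>\<^bsub>Ggrp X\<^esub>) (L @ ys @ S) \<one>\<^bsub>Ggrp X\<^esub>"
    if "foldr (\<otimes>\<^bsub>Ggrp X\<^esub>) xs \<one>\<^bsub>Ggrp X\<^esub> = foldr (\<otimes>\<^bsub>Ggrp X\<^esub>) ys \<one>\<^bsub>Ggrp X\<^esub>"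
      "set xs \<subseteq> carrier (Ggrp X)" "set ys \<subseteq> carrier (Ggrp X)" for xs ys
    using Ggrp.mult_foldr(1)[OF that(2) Ggrp.mult_foldr(2)[OF LS(2)], of "\<one>\<^bsub>Ggrp X\<^esub>"]
      Ggrp.mult_foldr(1)[OF that(3) Ggrp.mult_foldr(2)[OF LS(2)], of "\<one>\<^bsub>Ggrp X\<^esub>"] that(1)
    by simp
  have objs: "set (strand_objs X D F i (pos D i) (piece_top (piece (D ! i)))) \<subseteq> carrier (Ggrp X)"
    "set (strand_objs X D F (Suc i) (pos D i) (piece_bot (piece (D ! i)))) \<subseteq> carrier (Ggrp X)"
    using line_objs_closed[of i] line_objs_closed[of "Suc i"] by (auto simp: line_objs_split[OF i])
  have pc: "set (map fst (piece_mors X D F i)) \<subseteq> carrier (Ggrp X)"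
    "set (map (mor_target X) (piece_mors X D F i)) \<subseteq> carrier (Ggrp X)"
    using piece_mors(1)[OF i] mor_target_closed by (force simp: mors_def)+
  note tensor = foldr_mor_tensor[OF strip_mors_closed[OF i], folded strip_mor_def]
  show "strip_mor X D F i \<in> mors"
    by (rule tensor(1))
  show "fst (strip_mor X D F i) = foldr (\<otimes>\<^bsub>Ggrp X\<^esub>) (line_objs X D F i) \<one>\<^bsub>Ggrp X\<^esub>"
    using tensor(2) swap[OF piece_mors(2)[OF i] pc(1) objs(1)] maps(1) LS
    unfolding line_objs_split(1)[OF i] strand_mors_eq map_append L_def S_def by metis
  show "mor_target X (strip_mor X D F i) = foldr (\<otimes>\<^bsub>Ggrp X\<^esub>) (line_objs X D F (Suc i)) \<one>\<^bsub>Ggrp X\<^esub>"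
    using tensor(3) swap[OF piece_mors(3)[OF i] pc(2) objs(2)] maps(2) LS
    unfolding line_objs_split(2)[OF i] strand_mors_eq map_append L_def S_def by metis
qed

text \<open>Consecutive strips are composable: the target of one and the source of the next are the
  product along their common line.\<close>

lemma comp_strips:
  assumes "n \<le> length D"
  defines "m \<equiv> foldl (mor_comp X) (mor_id X \<one>\<^bsub>Ggrp X\<^esub>) (map (strip_mor X D F) [0..<n])"
  shows "m \<in> mors \<and> fst m = \<one>\<^bsub>Ggrp X\<^esub> \<and>
    mor_target X m = foldr (\<otimes>\<^bsub>Ggrp X\<^esub>) (line_objs X D F n) \<one>\<^bsub>Ggrp X\<^esub>"
  using assms(1) unfolding m_def
proof (induction n)
  case 0
  then show ?case
    using line_0[OF link] by (simp add: line_objs_def mor_id)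
next
  case (Suc n)
  then show ?case
    using mor_comp strip_mor[of n] by simp
qed

text \<open>The line below the last strip is empty, so the total composite runs from the unit object
  to itself and its \<open>E\<close>-component has trivial boundary.\<close>

lemma evaluation_in_kernel:
  "evaluation X D F \<in> kernel (Egrp X) (Ggrp X) (bd X)"
  using comp_strips[of "length D"]
  by (auto simp: evaluation_def kernel_def mors_def mor_target_def line_objs_def line_def)

end

section \<open>The crossed module of a group and an abelian group\<close>

lemma product_xmod_simps [simp]:
  "Egrp (product_xmod G V) = G \<times>\<times> add_monoid V"
  "Ggrp (product_xmod G V) = G"
  "bd (product_xmod G V) = fst"
  "act (product_xmod G V) g e = (g \<otimes>\<^bsub>G\<^esub> fst e \<otimes>\<^bsub>G\<^esub> inv\<^bsub>G\<^esub> g, snd e)"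
  by (simp_all add: product_xmod_def case_prod_beta)

lemma mult_DirProd_fst_snd:
  "x \<otimes>\<^bsub>G \<times>\<times> H\<^esub> y = (fst x \<otimes>\<^bsub>G\<^esub> fst y, snd x \<otimes>\<^bsub>H\<^esub> snd y)"
  by (simp add: DirProd_def case_prod_beta)

locale group_and_abelian_group = G: group G + V: abelian_group V
  for G :: "'g monoid" and V :: "('v, 'm) ring_scheme"
begin

lemma crossed_module_product_xmod: "crossed_module (product_xmod G V)"
proof -
  let ?X = "product_xmod G V"
  have "group (G \<times>\<times> add_monoid V)"
    by (intro DirProd_group G.group_axioms V.a_group)
  moreover have "fst \<in> hom (G \<times>\<times> add_monoid V) G"
    by (auto simp: hom_def)
  moreover have "act ?X g \<in> iso (Egrp ?X) (Egrp ?X)" if "g \<in> carrier G" for g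
  proof -
    have "bij_betw (act ?X g) (carrier (Egrp ?X)) (carrier (Egrp ?X))"
      using that
      by (intro bij_betwI[where g = "act ?X (inv\<^bsub>G\<^esub> g)"])
        (auto simp: G.m_assoc G.inv_cancel_left)
    moreover have "act ?X g \<in> hom (Egrp ?X) (Egrp ?X)"
      using that by (auto simp: hom_def G.m_assoc G.inv_cancel_left)
    ultimately show ?thesis by (simp add: iso_def)
  qed
  \<comment> \<open>The Peiffer identity: conjugation in the product leaves the second component
    alone because \<open>V\<close> is abelian.\<close>
  moreover have "act ?X (fst e) f
      = e \<otimes>\<^bsub>Egrp ?X\<^esub> f \<otimes>\<^bsub>Egrp ?X\<^esub> inv\<^bsub>Egrp ?X\<^esub> e"
    if "e \<in> carrier (Egrp ?X)" "f \<in> carrier (Egrp ?X)" for e f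
  proof -
    obtain g v h u where "e = (g, v)" "f = (h, u)" by (metis surj_pair)
    with that show ?thesis
      by (simp add: inv_DirProd[OF G.group_axioms V.a_group] V.a_ac V.r_neg
          flip: a_inv_def)
  qed
  ultimately show ?thesis
    by (auto simp: crossed_module_def G.group_axioms G.m_assoc G.inv_mult_group)
qed

lemma iso_kernel_product_xmod:
  "(\<lambda>v. (\<one>\<^bsub>G\<^esub>, v)) \<in> iso (add_monoid V)
    ((Egrp (product_xmod G V))\<lparr>carrier :=
      kernel (Egrp (product_xmod G V)) (Ggrp (product_xmod G V)) (bd (product_xmod G V))\<rparr>)"
  by (auto simp: iso_def hom_def kernel_def bij_betw_def inj_on_def)

sublocale crossed_mod "product_xmod G V"
  by standard (rule crossed_module_product_xmod)

text \<open>The action conjugates only the \<open>G\<close>-component, so the target of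
  \<open>m\<close> does not influence the \<open>V\<close>-component.\<close>

lemma snd_mor_tensor:
  "snd (snd (mor_tensor (product_xmod G V) m n)) = snd (snd n) \<oplus>\<^bsub>V\<^esub> snd (snd m)"
  by (simp add: mor_tensor_def mult_DirProd_fst_snd)

lemma snd_foldr_mor_id:
  assumes "snd (snd m) \<in> carrier V"
  shows "snd (snd (foldr (mor_tensor (product_xmod G V)) (map (mor_id (product_xmod G V)) xs) m))
    = snd (snd m)"
  using assms by (induction xs) (auto simp: snd_mor_tensor mor_id_def)

end

section \<open>The evaluation as a sum over crossings\<close>

locale product_coloured_link =
  group_and_abelian_group G V + coloured_link "product_xmod G V" \<psi> \<phi> D F
  for G :: "'g monoid" and V :: "('v, 'm) ring_scheme" and \<psi> \<phi> D F
begin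

lemma crossing_colour_snd_closed: "i \<in> crossings D \<Longrightarrow> snd (snd F i) \<in> carrier V"
  using crossing_colour_closed[of i] by (auto simp: mem_Times_iff)

lemma snd_strip_mor:
  assumes "i < length D"
  shows "snd (snd (strip_mor (product_xmod G V) D F i))
    = (if i \<in> crossings D then snd (snd F i) else \<zero>\<^bsub>V\<^esub>)"
proof -
  let ?X = "product_xmod G V"
  \<comment> \<open>The strands to the right of the piece, followed by the unit, contribute
    zero.\<close>
  have nil: "snd (snd (foldr (mor_tensor ?X) (map (mor_id ?X) xs) (mor_id ?X \<one>\<^bsub>G\<^esub>))) = \<zero>\<^bsub>V\<^esub>" for xs
    by (subst snd_foldr_mor_id) (auto simp: mor_id_def)
  have "snd (snd (foldr (mor_tensor ?X) (piece_mors ?X D F i)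
      (foldr (mor_tensor ?X) (map (mor_id ?X) xs) (mor_id ?X \<one>\<^bsub>G\<^esub>))))
    = (if i \<in> crossings D then snd (snd F i) else \<zero>\<^bsub>V\<^esub>)" for xs
    using crossing_colour_snd_closed[of i] assms
    by (auto simp: piece_mors_def snd_mor_tensor nil crossings_def pos_crossings_def
        neg_crossings_def Let_def split: option.splits piece.splits)
  moreover have "(if i \<in> crossings D then snd (snd F i) else \<zero>\<^bsub>V\<^esub>) \<in> carrier V"
    using crossing_colour_snd_closed[of i] by auto
  ultimately show ?thesis
    unfolding strip_mor_def strand_mors_eq foldr_append product_xmod_simps comp_def
    by (subst snd_foldr_mor_id) auto
qed

text \<open>Composition adds \<open>V\<close>-components, and a crossing is named by the index of
  its strip, so the first \<open>n\<close> strips account for the crossings below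
  \<open>n\<close>.\<close>

lemma snd_comp_strips:
  assumes "n \<le> length D"
  shows "snd (snd (foldl (mor_comp (product_xmod G V)) (mor_id (product_xmod G V) \<one>\<^bsub>G\<^esub>)
      (map (strip_mor (product_xmod G V) D F) [0..<n])))
    = (\<Oplus>\<^bsub>V\<^esub>i\<in>crossings D \<inter> {..<n}. snd (snd F i))"
  using assms
proof (induction n)
  case 0
  then show ?case by (simp add: mor_id_def)
next
  case (Suc n)
  have closed: "(\<lambda>i. snd (snd F i)) \<in> crossings D \<inter> A \<rightarrow> carrier V" for A
    using crossing_colour_snd_closed by auto
  have "crossings D \<inter> {..<Suc n} =
      (if n \<in> crossings D then insert n (crossings D \<inter> {..<n}) else crossings D \<inter> {..<n})"
    by (auto simp: lessThan_Suc)
  with Suc closed show ?case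
    by (auto simp: mor_comp_def mult_DirProd_fst_snd snd_strip_mor crossing_colour_snd_closed)
qed

text \<open>The kernel of \<open>fst\<close> forces the first component to be the unit; composing
  all strips gives the second.\<close>

lemma evaluation_product_xmod:
  "evaluation (product_xmod G V) D F = (\<one>\<^bsub>G\<^esub>, \<Oplus>\<^bsub>V\<^esub>i\<in>crossings D. snd (snd F i))"
proof (rule prod_eqI)
  show "fst (evaluation (product_xmod G V) D F) = fst (\<one>\<^bsub>G\<^esub>, \<Oplus>\<^bsub>V\<^esub>i\<in>crossings D. snd (snd F i))"
    using evaluation_in_kernel by (simp add: kernel_def)
  have "crossings D \<inter> {..<length D} = crossings D"
    using crossings_subset by blast
  then show "snd (evaluation (product_xmod G V) D F)
      = snd (\<one>\<^bsub>G\<^esub>, \<Oplus>\<^bsub>V\<^esub>i\<in>crossings D. snd (snd F i))"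
    using snd_comp_strips[of "length D"] by (simp add: evaluation_def)
qed

end

section \<open>The Reidemeister pair of a rack cocycle\<close>

locale rack_cocycle_pair = rack R ra la + group_and_abelian_group G V
  for R :: "'r set"
    and ra :: "'r \<Rightarrow> 'r \<Rightarrow> 'r" (infixl "\<triangleright>" 70)
    and la :: "'r \<Rightarrow> 'r \<Rightarrow> 'r" (infixl "\<triangleleft>" 70)
    and G :: "'r monoid"
    and V :: "('v, 'm) ring_scheme" +
  fixes w :: "'r \<Rightarrow> 'r \<Rightarrow> 'v"
    and \<psi> \<phi> :: "'r \<Rightarrow> 'r \<Rightarrow> 'r \<times> 'v"
  assumes cocycle: "rack_2cocycle R (\<triangleleft>) V w"
    and carrier_G [simp]: "carrier G = R"
    and \<psi>: "\<And>a b. \<lbrakk>a \<in> R; b \<in> R\<rbrakk> \<Longrightarrow>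
      \<psi> b a = (b \<otimes>\<^bsub>G\<^esub> a \<otimes>\<^bsub>G\<^esub> inv\<^bsub>G\<^esub> b \<otimes>\<^bsub>G\<^esub> inv\<^bsub>G\<^esub> (b \<triangleright> a), w (b \<triangleright> a) b)"
    and \<phi>: "\<And>a b. \<lbrakk>a \<in> R; b \<in> R\<rbrakk> \<Longrightarrow>
      \<phi> b a = (a \<otimes>\<^bsub>G\<^esub> b \<otimes>\<^bsub>G\<^esub> inv\<^bsub>G\<^esub> (a \<triangleleft> b) \<otimes>\<^bsub>G\<^esub> inv\<^bsub>G\<^esub> b, \<ominus>\<^bsub>V\<^esub> w a b)"
begin

lemma w_closed: "\<lbrakk>x \<in> R; y \<in> R\<rbrakk> \<Longrightarrow> w x y \<in> carrier V"
  using cocycle by (simp add: rack_2cocycle_def)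

lemma w_cocycle:
  "\<lbrakk>x \<in> R; y \<in> R; z \<in> R\<rbrakk> \<Longrightarrow>
     w x y \<oplus>\<^bsub>V\<^esub> w (x \<triangleleft> y) z = w x z \<oplus>\<^bsub>V\<^esub> w (x \<triangleleft> z) (y \<triangleleft> z)"
  using cocycle by (simp add: rack_2cocycle_def)

lemmas G_closed = G.m_closed[unfolded carrier_G] G.inv_closed[unfolded carrier_G]

lemmas G_simps = G.m_assoc G.inv_mult_group G.inv_cancel_left

section \<open>The conditions of a Reidemeister pair\<close>

lemma pair_maps: "pair_maps (product_xmod G V) \<psi> \<phi>"
  by (simp add: pair_maps_def \<psi> \<phi> G_closed ra_closed la_closed w_closed)

lemma psi_under_eq:
  "\<lbrakk>a \<in> R; b \<in> R\<rbrakk> \<Longrightarrow> psi_under (product_xmod G V) \<psi> b a = b \<triangleright> a"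
  by (simp add: psi_under_def \<psi> G_closed G_simps ra_closed)

lemma phi_under_eq:
  "\<lbrakk>a \<in> R; b \<in> R\<rbrakk> \<Longrightarrow> phi_under (product_xmod G V) \<phi> b a = a \<triangleleft> b"
  by (simp add: phi_under_def \<phi> G_closed G_simps la_closed)

text \<open>For \<open>Z = Y \<triangleleft> X\<close> the axiom \<open>ra_la\<close> gives
  \<open>X \<triangleright> Z = Y\<close>, which makes \<open>\<psi> X Z\<close> the inverse of
  \<open>\<phi> X Y\<close> in both components.\<close>

lemma R2: "Reidemeister_R2 (product_xmod G V) \<psi> \<phi>"
  by (simp add: Reidemeister_R2_def phi_under_eq \<psi> \<phi> ra_la la_closed G_closed G_simps
      w_closed V.l_neg)

text \<open>After cancellation the \<open>G\<close>-components become \<open>X Y T ((X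
  \<triangleleft> Y) \<triangleleft> T)\<inverse> (Y \<triangleleft> T)\<inverse>
  T\<inverse>\<close> and the same word with
  \<open>(X \<triangleleft> T) \<triangleleft> (Y \<triangleleft> T)\<close> in the bracket, equal
  by \<open>la_distrib\<close>. The \<open>V\<close>-components are the negated cocycle identity
  with \<open>w Y T\<close> subtracted on both sides.\<close>

lemma R3: "Reidemeister_R3 (product_xmod G V) \<phi>"
proof -
  have "\<ominus>\<^bsub>V\<^esub> w x y \<oplus>\<^bsub>V\<^esub> \<ominus>\<^bsub>V\<^esub> w (x \<triangleleft> y) t \<oplus>\<^bsub>V\<^esub> \<ominus>\<^bsub>V\<^esub> w y t
      = \<ominus>\<^bsub>V\<^esub> w y t \<oplus>\<^bsub>V\<^esub> \<ominus>\<^bsub>V\<^esub> w x t \<oplus>\<^bsub>V\<^esub> \<ominus>\<^bsub>V\<^esub> w (x \<triangleleft> t) (y \<triangleleft> t)"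
    if "x \<in> R" "y \<in> R" "t \<in> R" for x y t
  proof -
    have "\<ominus>\<^bsub>V\<^esub> w x y \<oplus>\<^bsub>V\<^esub> \<ominus>\<^bsub>V\<^esub> w (x \<triangleleft> y) t
        = \<ominus>\<^bsub>V\<^esub> w x t \<oplus>\<^bsub>V\<^esub> \<ominus>\<^bsub>V\<^esub> w (x \<triangleleft> t) (y \<triangleleft> t)"
      using w_cocycle[OF that] that by (simp add: w_closed la_closed flip: V.minus_add)
    with that show ?thesis
      by (simp add: w_closed la_closed V.a_ac)
  qed
  then show ?thesis
    by (simp add: Reidemeister_R3_def Let_def phi_under_eq \<phi> la_closed G_closed G_simps
        la_distrib[symmetric])
qed

text \<open>The left side collapses to \<open>Z A (Z \<triangleleft> A)\<inverse>\<close>, so the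
  equation says \<open>Z \<triangleleft> A = A\<close>, and \<open>la_fixed_iff\<close> identifies
  its only solution.\<close>

lemma framing_eq_iff:
  assumes "A \<in> R" "Z \<in> R"
  shows "fst (\<phi> A Z) \<otimes>\<^bsub>G\<^esub> A = Z \<longleftrightarrow> A = Z \<triangleleft> Z"
proof -
  have "fst (\<phi> A Z) \<otimes>\<^bsub>G\<^esub> A = Z \<otimes>\<^bsub>G\<^esub> (A \<otimes>\<^bsub>G\<^esub> inv\<^bsub>G\<^esub> (Z \<triangleleft> A))"
    using assms by (simp add: \<phi> G_closed G_simps la_closed)
  also have "\<dots> = Z \<longleftrightarrow> A \<otimes>\<^bsub>G\<^esub> inv\<^bsub>G\<^esub> (Z \<triangleleft> A) = \<one>\<^bsub>G\<^esub>"
    using assms G.r_cancel_one[of Z] by (simp add: G_closed la_closed)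
  also have "\<dots> \<longleftrightarrow> Z \<triangleleft> A = A"
    using assms G.inv_equality[of A "inv\<^bsub>G\<^esub> (Z \<triangleleft> A)"]
    by (auto simp: G_closed G_simps la_closed)
  also have "\<dots> \<longleftrightarrow> A = Z \<triangleleft> Z"
    using assms by (rule la_fixed_iff)
  finally show ?thesis .
qed

lemma framing_f_eq:
  assumes "Z \<in> R"
  shows "framing_f (product_xmod G V) \<phi> Z = Z \<triangleleft> Z"
  unfolding framing_f_def
  by (rule the_equality) (use assms in \<open>auto simp: framing_eq_iff la_closed\<close>)

lemma framing_g_eq:
  assumes "A \<in> R"
  shows "framing_g (product_xmod G V) \<psi> A = A \<triangleright> A"
  using assms by (simp add: framing_g_def \<psi> G_closed G_simps ra_closed)

theorem framed: "framed_Reidemeister_pair (product_xmod G V) \<psi> \<phi>"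
proof -
  have "\<exists>!A. A \<in> R \<and> fst (\<phi> A Z) \<otimes>\<^bsub>G\<^esub> A = Z" if "Z \<in> R" for Z
    by (rule ex1I[of _ "Z \<triangleleft> Z"]) (use that in \<open>auto simp: framing_eq_iff la_closed\<close>)
  then show ?thesis
    by (simp add: framed_Reidemeister_pair_def pair_maps R2 R3 framing_f_eq framing_g_eq
        la_closed ra_closed la_ra_square ra_la_square)
qed

text \<open>Idempotence trivialises the \<open>G\<close>-component of \<open>\<psi> X X\<close> and
  turns its \<open>V\<close>-component into \<open>w X X\<close>, which vanishes.\<close>

theorem unframed:
  assumes "quandle R (\<triangleright>) (\<triangleleft>)" "quandle_2cocycle R (\<triangleleft>) V w"
  shows "unframed_Reidemeister_pair (product_xmod G V) \<psi> \<phi>"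
proof -
  have "x \<triangleright> x = x" "w x x = \<zero>\<^bsub>V\<^esub>" if "x \<in> R" for x
    using assms quandle.ra_idem that by (fastforce simp: quandle_2cocycle_def)+
  then have "Reidemeister_R1 (product_xmod G V) \<psi>"
    by (simp add: Reidemeister_R1_def \<psi> G_closed G_simps)
  then show ?thesis
    by (simp add: unframed_Reidemeister_pair_def pair_maps R2 R3)
qed

section \<open>Comparison of the state sum with the cocycle invariant\<close>

lemma fst_colourings_bij:
  assumes "link_diagram D"
  shows "bij_betw fst (Reidemeister_colourings (product_xmod G V) \<psi> \<phi> D)
    (rack_colourings R (\<triangleright>) (\<triangleleft>) D)"
proof -
  \<comment> \<open>Arc colours determine crossing colours, which provides the inverse of
    \<open>fst\<close>. The restriction to \<open>crossings D\<close> matches the convention that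
    colourings are undefined elsewhere.\<close>
  define crossing_colours where "crossing_colours c = (\<lambda>i\<in>crossings D.
    (if i \<in> pos_crossings D then \<psi> else \<phi>) (c (over_arc D i)) (c (lower_under_arc D i)))" for c
  have cr: "i \<in> crossings D" if "i \<in> pos_crossings D \<or> i \<in> neg_crossings D" for i
    using that by (auto simp: crossings_def)
  have colour: "c (over_arc D i) \<in> R" "c (lower_under_arc D i) \<in> R"
    if "c \<in> arcs D \<rightarrow>\<^sub>E R" "i \<in> crossings D" for c i
    using that crossing_arcs[OF assms that(2)] by auto
  have neg: "i \<notin> pos_crossings D" if "i \<in> neg_crossings D" for i
    using that pos_neg_crossings_disjoint by auto
  show ?thesis
  proof (rule bij_betwI[where g = "\<lambda>c. (c, crossing_colours c)"])
    show "fst \<in> Reidemeister_colourings (product_xmod G V) \<psi> \<phi> D \<rightarrow> rack_colourings R (\<triangleright>) (\<triangleleft>) D"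
      by (auto simp: Reidemeister_colourings_def rack_colourings_def psi_under_eq phi_under_eq
          colour cr)
    show "(\<lambda>c. (c, crossing_colours c)) \<in> rack_colourings R (\<triangleright>) (\<triangleleft>) D \<rightarrow>
        Reidemeister_colourings (product_xmod G V) \<psi> \<phi> D"
    proof
      fix c assume "c \<in> rack_colourings R (\<triangleright>) (\<triangleleft>) D"
      then have c: "c \<in> arcs D \<rightarrow>\<^sub>E R"
        and up: "\<And>i. i \<in> pos_crossings D \<Longrightarrow>
            c (upper_under_arc D i) = c (over_arc D i) \<triangleright> c (lower_under_arc D i)"
          "\<And>i. i \<in> neg_crossings D \<Longrightarrow>
            c (upper_under_arc D i) = c (lower_under_arc D i) \<triangleleft> c (over_arc D i)"
        by (auto simp: rack_colourings_def)
      have "crossing_colours c \<in> crossings D \<rightarrow>\<^sub>E carrier (Egrp (product_xmod G V))"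
        using pair_maps colour[OF c] by (auto simp: crossing_colours_def pair_maps_def)
      then show "(c, crossing_colours c) \<in> Reidemeister_colourings (product_xmod G V) \<psi> \<phi> D"
        using c by (auto simp: Reidemeister_colourings_def psi_under_eq phi_under_eq colour[OF c]
            cr neg up crossing_colours_def)
    qed
    show "(fst F, crossing_colours (fst F)) = F"
      if F: "F \<in> Reidemeister_colourings (product_xmod G V) \<psi> \<phi> D" for F
    proof -
      have "crossing_colours (fst F) i = snd F i" for i
        using F neg by (auto simp: Reidemeister_colourings_def crossing_colours_def crossings_def
            PiE_iff extensional_def)
      then show ?thesis by (auto intro!: prod_eqI)
    qed
  qed simp
qed

text \<open>At a positive crossing \<open>b \<triangleright> a\<close> is the colour of the upper
  under-arc, at a negative one \<open>a\<close> is that of the lower. In both cases this is the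
  source under-arc, and the sign of \<open>w\<close> in \<open>\<psi>\<close> or
  \<open>\<phi>\<close> is the crossing sign.\<close>

lemma evaluation_eq:
  assumes "link_diagram D" and F: "F \<in> Reidemeister_colourings (product_xmod G V) \<psi> \<phi> D"
  shows "evaluation (product_xmod G V) D F = (\<one>\<^bsub>G\<^esub>, \<Oplus>\<^bsub>V\<^esub>i\<in>crossings D.
    [crossing_sign D i] \<cdot>\<^bsub>V\<^esub> w (fst F (source_under_arc D i)) (fst F (over_arc D i)))"
proof -
  interpret product_coloured_link G V \<psi> \<phi> D F
    using assms by unfold_locales
  have "snd (snd F i)
      = [crossing_sign D i] \<cdot>\<^bsub>V\<^esub> w (fst F (source_under_arc D i)) (fst F (over_arc D i))"
    if i: "i \<in> crossings D" for i
  proof -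
    have colour [simp]: "fst F (over_arc D i) \<in> R" "fst F (lower_under_arc D i) \<in> R"
      using colour_closed crossing_arcs[OF assms(1) i] by auto
    show ?thesis
    proof (cases "i \<in> pos_crossings D")
      case True
      then have "snd F i = \<psi> (fst F (over_arc D i)) (fst F (lower_under_arc D i))"
        "fst F (upper_under_arc D i) = fst F (over_arc D i) \<triangleright> fst F (lower_under_arc D i)"
        using F psi_under_eq[OF colour(2,1)] by (auto simp: Reidemeister_colourings_def)
      with True show ?thesis
        by (simp add: \<psi> crossing_sign_def source_under_arc_def ra_closed w_closed)
    next
      case False
      with i have "i \<in> neg_crossings D" by (simp add: crossings_def)
      then have "snd F i = \<phi> (fst F (over_arc D i)) (fst F (lower_under_arc D i))"
        using F by (auto simp: Reidemeister_colourings_def)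
      with False show ?thesis
        by (simp add: \<phi> crossing_sign_def source_under_arc_def V.add.int_pow_neg w_closed)
    qed
  qed
  moreover from this have "(\<lambda>i. snd (snd F i)) \<in> crossings D \<rightarrow> carrier V"
    using crossing_colour_snd_closed by auto
  ultimately show ?thesis
    unfolding evaluation_product_xmod by (auto intro!: V.add.finprod_cong' simp: Pi_iff)
qed

text \<open>The right side applies the additive map of group rings induced by
  \<open>v \<mapsto> (\<one>, v)\<close>. Finitely many arcs and colours make the sum over
  colourings finite, so this map passes through it; then the sum is reindexed along
  \<open>fst\<close>.\<close>

theorem state_sum_eq:
  assumes "finite R" "link_diagram D"
  shows "state_sum (product_xmod G V) \<psi> \<phi> D
    = frag_extend (frag_of \<circ> (\<lambda>v. (\<one>\<^bsub>G\<^esub>, v))) (rack_cocycle_invariant R (\<triangleright>) (\<triangleleft>) V w D)"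
proof -
  define q where "q c = (\<Oplus>\<^bsub>V\<^esub>i\<in>crossings D.
    [crossing_sign D i] \<cdot>\<^bsub>V\<^esub> w (c (source_under_arc D i)) (c (over_arc D i)))" for c
  have "finite (rack_colourings R (\<triangleright>) (\<triangleleft>) D)"
    by (rule finite_subset[of _ "arcs D \<rightarrow>\<^sub>E R"])
      (auto simp: rack_colourings_def assms(1) finite_arcs intro!: finite_PiE)
  then have "frag_extend (frag_of \<circ> (\<lambda>v. (\<one>\<^bsub>G\<^esub>, v))) (rack_cocycle_invariant R (\<triangleright>) (\<triangleleft>) V w D)
      = (\<Sum>c\<in>rack_colourings R (\<triangleright>) (\<triangleleft>) D. frag_of (\<one>\<^bsub>G\<^esub>, q c))"
    by (simp add: rack_cocycle_invariant_def frag_extend_sum q_def)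
  also have "\<dots> = (\<Sum>F\<in>Reidemeister_colourings (product_xmod G V) \<psi> \<phi> D. frag_of (\<one>\<^bsub>G\<^esub>, q (fst F)))"
    by (rule sum.reindex_bij_betw[OF fst_colourings_bij[OF assms(2)], symmetric])
  also have "\<dots> = state_sum (product_xmod G V) \<psi> \<phi> D"
    unfolding state_sum_def
    by (intro sum.cong refl) (simp add: evaluation_eq[OF assms(2)] q_def)
  finally show ?thesis by simp
qed

end

theorem theorem4p6:
  fixes R :: "'r set"
    and ra :: "'r \<Rightarrow> 'r \<Rightarrow> 'r" (infixl "\<triangleright>" 70)
    and la :: "'r \<Rightarrow> 'r \<Rightarrow> 'r" (infixl "\<triangleleft>" 70)
    and V :: "('v, 'm) ring_scheme"
    and w :: "'r \<Rightarrow> 'r \<Rightarrow> 'v"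
    and G :: "'r monoid"
    and \<G> :: "('r, 'r \<times> 'v) xmod"
    and \<psi> \<phi> :: "'r \<Rightarrow> 'r \<Rightarrow> 'r \<times> 'v"
    and \<iota> :: "'v \<Rightarrow> 'r \<times> 'v"
  assumes rack: "rack R (\<triangleright>) (\<triangleleft>)" and fin: "finite R"
    and V: "abelian_group V"
    and w: "rack_2cocycle R (\<triangleleft>) V w"
    and G: "group G" "carrier G = R"
    and \<G>: "\<G> = product_xmod G V"
    and \<psi>: "\<And>a b. \<lbrakk>a \<in> R; b \<in> R\<rbrakk> \<Longrightarrow>
      \<psi> b a = (b \<otimes>\<^bsub>G\<^esub> a \<otimes>\<^bsub>G\<^esub> inv\<^bsub>G\<^esub> b \<otimes>\<^bsub>G\<^esub> inv\<^bsub>G\<^esub> (b \<triangleright> a), w (b \<triangleright> a) b)"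
    and \<phi>: "\<And>a b. \<lbrakk>a \<in> R; b \<in> R\<rbrakk> \<Longrightarrow>
      \<phi> b a = (a \<otimes>\<^bsub>G\<^esub> b \<otimes>\<^bsub>G\<^esub> inv\<^bsub>G\<^esub> (a \<triangleleft> b) \<otimes>\<^bsub>G\<^esub> inv\<^bsub>G\<^esub> b, \<ominus>\<^bsub>V\<^esub> w a b)"
    and \<iota>: "\<iota> = (\<lambda>v. (\<one>\<^bsub>G\<^esub>, v))"
  shows "crossed_module \<G>
    \<and> \<iota> \<in> iso (add_monoid V)
        ((Egrp \<G>)\<lparr>carrier := kernel (Egrp \<G>) (Ggrp \<G>) (bd \<G>)\<rparr>)
    \<and> framed_Reidemeister_pair \<G> \<psi> \<phi>
    \<and> (\<forall>D. link_diagram D \<longrightarrow>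
         state_sum \<G> \<psi> \<phi> D
         = frag_extend (frag_of \<circ> \<iota>) (rack_cocycle_invariant R (\<triangleright>) (\<triangleleft>) V w D))
    \<and> (quandle R (\<triangleright>) (\<triangleleft>) \<and> quandle_2cocycle R (\<triangleleft>) V w \<longrightarrow>
         unframed_Reidemeister_pair \<G> \<psi> \<phi>
         \<and> (\<forall>D. link_diagram D \<longrightarrow>
              state_sum \<G> \<psi> \<phi> D
              = frag_extend (frag_of \<circ> \<iota>) (rack_cocycle_invariant R (\<triangleright>) (\<triangleleft>) V w D)))"
proof -
  interpret G: group G by (rule G(1))
  interpret V: abelian_group V by (rule V)
  interpret rack R ra la by (rule rack)
  interpret rack_cocycle_pair R ra la G V w \<psi> \<phi>
    by unfold_locales (use w G(2) \<psi> \<phi> in auto)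
  show ?thesis
    unfolding \<G> \<iota>
    using crossed_module_product_xmod iso_kernel_product_xmod framed unframed state_sum_eq[OF fin]
    by blast
qed

end
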